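(* Let $D\subset\mathbb{R}^d$ be a nonempty open set. Then the shot-down time $$\sigma_D=\inf\{t>0:\ [X_{t^-},X_t]\cap D^c\neq\emptyset\}$$ is a stopping time.
   Context: $d\ge 1$, $0<\alpha<2$. $X=(X_t)_{t\ge 0}$ is the standard isotropic $\alpha$-stable Lévy process in $\mathbb{R}^d$ with càdlàg paths (right continuous with left limits), i.e. the Lévy process whose increments satisfy $\mathbb{E}\,e^{i\xi\cdot(X_t-X_0)}=e^{-t|\xi|^\alpha}$, $\xi\in\mathbb{R}^d$. $X_{t^-}=\lim_{s\to t^-}X_s$ for $t>0$, $X_{0-}=X_0$; $[v,w]$ is the line segment between $v,w\in\mathbb{R}^d$; $D^c=\mathbb{R}^d\setminus D$; $\inf\emptyset=\infty$. "Stopping time" is with respect to the usual (right-continuous, completed) filtration of $X$. *)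

theory Defs
  imports "HOL-Probability.Probability"
begin

text \<open>
  A path is a function on \<^typ>\<open>real\<close> of which only the restriction to \<open>[0, \<infinity>)\<close> matters.
\<close>

definition cadlag :: "(real \<Rightarrow> 'b::topological_space) \<Rightarrow> bool" where
  "cadlag f \<longleftrightarrow> (\<forall>t\<ge>0. (f \<longlongrightarrow> f t) (at_right t)) \<and> (\<forall>t>0. \<exists>l. (f \<longlongrightarrow> l) (at_left t))"

definition left_lim :: "(real \<Rightarrow> 'b::t2_space) \<Rightarrow> real \<Rightarrow> 'b" where
  "left_lim f t = (if t = 0 then f 0 else Lim (at_left t) f)"

text \<open>
  The starting point \<^term>\<open>X 0\<close> is an arbitrary random vector, so that every deterministic start is
  included; it is part of the independent family in \<open>independent_increments\<close>, where
  \<open>0 = t 0 < t 1 < \<dots> < t n\<close>. Stochastic continuity follows from right continuity of the paths and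
  stationarity, and is therefore not listed.
\<close>

locale cadlag_levy_process = prob_space M
  for M :: "'w measure" +
  fixes X :: "real \<Rightarrow> 'w \<Rightarrow> 'b::euclidean_space"
  assumes random_vector: "\<And>t. 0 \<le> t \<Longrightarrow> X t \<in> borel_measurable M"
    and cadlag_paths: "\<And>\<omega>. \<omega> \<in> space M \<Longrightarrow> cadlag (\<lambda>t. X t \<omega>)"
    and independent_increments:
      "\<And>(n::nat) t. t 0 = 0 \<Longrightarrow> strict_mono_on {..n} t \<Longrightarrow>
        indep_vars (\<lambda>_. borel)
          (\<lambda>k \<omega>. if k = 0 then X 0 \<omega> else X (t k) \<omega> - X (t (k - 1)) \<omega>) {..n}"
    and stationary_increments:
      "\<And>s h. 0 \<le> s \<Longrightarrow> 0 \<le> h \<Longrightarrow>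
        distr M borel (\<lambda>\<omega>. X (s + h) \<omega> - X s \<omega>) = distr M borel (\<lambda>\<omega>. X h \<omega> - X 0 \<omega>)"

locale isotropic_stable_process = cadlag_levy_process M X
  for M :: "'w measure" and X :: "real \<Rightarrow> 'w \<Rightarrow> 'b::euclidean_space" +
  fixes \<alpha> :: real
  assumes characteristic_function:
    "\<And>t \<xi>. 0 \<le> t \<Longrightarrow>
      (CLINT \<omega>|M. iexp (\<xi> \<bullet> (X t \<omega> - X 0 \<omega>))) = of_real (exp (- t * norm \<xi> powr \<alpha>))"

text \<open>
  Filtrations are indexed by \<open>[0, \<infinity>]\<close>, i.e. by \<^typ>\<open>ennreal\<close>, because stopping times may take the
  value \<open>\<infinity>\<close>. The index \<open>\<infinity>\<close> carries the \<open>\<sigma>\<close>-algebra generated by the whole process; it imposes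
  no condition on stopping times, as \<open>T \<le> \<infinity>\<close> always holds.
\<close>

definition natural_filtration ::
    "'w measure \<Rightarrow> (real \<Rightarrow> 'w \<Rightarrow> 'b::topological_space) \<Rightarrow> ennreal \<Rightarrow> 'w measure" where
  "natural_filtration M X t =
    sigma (space M) {X s -` B \<inter> space M |s B. 0 \<le> s \<and> ennreal s \<le> t \<and> B \<in> sets borel}"

definition negligible_events ::
    "'w measure \<Rightarrow> (real \<Rightarrow> 'w \<Rightarrow> 'b::topological_space) \<Rightarrow> 'w set set" where
  "negligible_events M X =
    {N. \<exists>N'. N \<subseteq> N' \<and> N' \<in> null_sets M \<and> N' \<in> sets (natural_filtration M X \<infinity>)}"

definition completed_filtration ::
    "'w measure \<Rightarrow> (real \<Rightarrow> 'w \<Rightarrow> 'b::topological_space) \<Rightarrow> ennreal \<Rightarrow> 'w measure" where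
  "completed_filtration M X t =
    sigma (space M) (sets (natural_filtration M X t) \<union> negligible_events M X)"

definition usual_filtration ::
    "'w measure \<Rightarrow> (real \<Rightarrow> 'w \<Rightarrow> 'b::topological_space) \<Rightarrow> ennreal \<Rightarrow> 'w measure" where
  "usual_filtration M X t =
    sigma (space M)
      (if t = \<infinity> then sets (completed_filtration M X \<infinity>)
       else (\<Inter>s\<in>{t<..}. sets (completed_filtration M X s)))"

lemma space_natural_filtration: "space (natural_filtration M X t) = space M"
  unfolding natural_filtration_def by (intro space_measure_of) auto

lemma sets_natural_filtration_mono:
  assumes "s \<le> t"
  shows "sets (natural_filtration M X s) \<subseteq> sets (natural_filtration M X t)"
proof -
  have "{X u -` B \<inter> space M |u B. 0 \<le> u \<and> ennreal u \<le> s \<and> B \<in> sets borel} \<subseteq>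
        {X u -` B \<inter> space M |u B. 0 \<le> u \<and> ennreal u \<le> t \<and> B \<in> sets borel}"
    using assms by (blast intro: order_trans)
  moreover have "{X u -` B \<inter> space M |u B. 0 \<le> u \<and> ennreal u \<le> r \<and> B \<in> sets borel} \<subseteq> Pow (space M)" for r
    by auto
  ultimately show ?thesis
    unfolding natural_filtration_def by (simp add: sets_measure_of sigma_sets_mono')
qed

lemma completed_filtration_generator:
  "sets (natural_filtration M X t) \<union> negligible_events M X \<subseteq> Pow (space M)"
proof -
  have "sets (natural_filtration M X r) \<subseteq> Pow (space M)" for r
    using sets.space_closed[of "natural_filtration M X r"] by (simp add: space_natural_filtration)
  then show ?thesis
    unfolding negligible_events_def by blast
qed

lemma space_completed_filtration: "space (completed_filtration M X t) = space M"
  unfolding completed_filtration_def by (intro space_measure_of completed_filtration_generator)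

lemma sets_completed_filtration_mono:
  assumes "s \<le> t"
  shows "sets (completed_filtration M X s) \<subseteq> sets (completed_filtration M X t)"
  unfolding completed_filtration_def sets_measure_of[OF completed_filtration_generator]
  using sets_natural_filtration_mono[OF assms, of M X] by (intro sigma_sets_mono') auto

lemma sets_usual_filtration:
  "sets (usual_filtration M X t) =
    (if t = \<infinity> then sets (completed_filtration M X \<infinity>)
     else (\<Inter>s\<in>{t<..}. sets (completed_filtration M X s)))"
proof (cases "t = \<infinity>")
  case True
  then show ?thesis
    using sets.sigma_sets_eq[of "completed_filtration M X \<infinity>"]
          sets.space_closed[of "completed_filtration M X \<infinity>"]
    by (simp add: usual_filtration_def sets_measure_of space_completed_filtration)
next
  case False
  then have "\<infinity> \<in> {t<..}" by (simp add: less_top)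
  have "sigma_algebra (space M) (\<Inter>s\<in>{t<..}. sets (completed_filtration M X s))"
  proof -
    let ?C = "\<lambda>s. sets (completed_filtration M X s)"
    have "(\<Inter>s\<in>{t<..}. ?C s) \<subseteq> Pow (space M)"
      using \<open>\<infinity> \<in> {t<..}\<close> sets.space_closed[of "completed_filtration M X \<infinity>"]
      unfolding space_completed_filtration by blast
    moreover have "space M - A \<in> ?C s" if "A \<in> ?C s" for A s
      using sets.compl_sets[OF that] by (simp add: space_completed_filtration)
    moreover have "\<Union> (range A) \<in> ?C s" if "range A \<subseteq> ?C s" for A :: "nat \<Rightarrow> _" and s
      using that by (rule sets.countable_UN)
    ultimately show ?thesis
      unfolding sigma_algebra_iff2 by (simp add: subset_iff)
  qed
  then show ?thesis
    using False by (simp add: usual_filtration_def sigma_algebra.sets_measure_of_eq)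
qed

lemma space_usual_filtration: "space (usual_filtration M X t) = space M"
proof -
  have "sets (completed_filtration M X s) \<subseteq> Pow (space M)" for s
    using sets.space_closed[of "completed_filtration M X s"] by (simp add: space_completed_filtration)
  moreover have "t \<noteq> \<infinity> \<Longrightarrow> \<infinity> \<in> {t<..}" by (simp add: less_top)
  ultimately have "(if t = \<infinity> then sets (completed_filtration M X \<infinity>)
       else (\<Inter>s\<in>{t<..}. sets (completed_filtration M X s))) \<subseteq> Pow (space M)"
    by auto
  then show ?thesis
    unfolding usual_filtration_def by (rule space_measure_of)
qed

lemma filtration_usual: "filtration (space M) (usual_filtration M X)"
proof
  fix i j :: ennreal assume ij: "i \<le> j"
  show "sets (usual_filtration M X i) \<subseteq> sets (usual_filtration M X j)"
  proof (cases "j = \<infinity>")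
    case True
    have "i \<noteq> \<infinity> \<Longrightarrow> \<infinity> \<in> {i<..}" by (simp add: less_top)
    with True show ?thesis by (auto simp: sets_usual_filtration)
  next
    case False
    with ij have "i \<noteq> \<infinity>" by (auto simp: top_unique)
    with False ij show ?thesis by (auto simp: sets_usual_filtration)
  qed
qed (rule space_usual_filtration)

text \<open>The infimum is taken in \<^typ>\<open>ennreal\<close>, where \<^prop>\<open>Inf {} = (\<infinity>::ennreal)\<close>.\<close>

definition shot_down_time ::
    "(real \<Rightarrow> 'w \<Rightarrow> 'b::euclidean_space) \<Rightarrow> 'b set \<Rightarrow> 'w \<Rightarrow> ennreal" where
  "shot_down_time X D \<omega> =
    Inf {ennreal t |t. 0 < t \<and> closed_segment (left_lim (\<lambda>s. X s \<omega>) t) (X t \<omega>) \<inter> - D \<noteq> {}}"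

end

theory Submission
  imports Defs
begin

text \<open>
  Right continuity of the usual filtration reduces the claim to the measurability of
  \<open>{\<sigma>\<^sub>D < c}\<close> with respect to \<open>(X\<^sub>s)\<^sub>s\<^sub>\<le>\<^sub>c\<close>. No debut theorem is needed for this: on a compact time
  interval the points of the segments \<open>[X\<^sub>s\<^sub>-, X\<^sub>s]\<close> are exactly the limits of points of chords
  \<open>[X\<^sub>q, X\<^sub>r]\<close> with \<open>q, r\<close> approaching a common time, so a segment meets the closed set \<open>D\<^sup>c\<close> if and
  only if chords at arbitrarily close rational times come arbitrarily close to \<open>D\<^sup>c\<close>. The latter is
  a countable condition on the path.
\<close>

section \<open>Segments and one-sided limits\<close>

text \<open>The set is a union of preimages of \<open>U\<close> under continuous maps, one for each
  segment parameter \<open>u\<close>. This serves twice: to pass from one-sided limits to nearby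
  chords, and to make chord conditions Borel.\<close>

lemma open_segments_meeting:
  fixes U :: "'a::real_normed_vector set"
  assumes "open U"
  shows "open {p. closed_segment (fst p) (snd p) \<inter> U \<noteq> {}}"
proof -
  have "{p. closed_segment (fst p) (snd p) \<inter> U \<noteq> {}} =
      (\<Union>u\<in>{0..1}. (\<lambda>p. (1 - u) *\<^sub>R fst p + u *\<^sub>R snd p) -` U)"
    by (force simp: closed_segment_def)
  moreover have "open ((\<lambda>p::'a \<times> 'a. (1 - u) *\<^sub>R fst p + u *\<^sub>R snd p) -` U)" for u
    by (intro open_vimage assms continuous_intros)
  ultimately show ?thesis
    by auto
qed

lemma cadlag_tendsto_left_lim:
  assumes "cadlag f" "0 < t"
  shows "(f \<longlongrightarrow> left_lim f t) (at_left t)"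
proof -
  obtain l where l: "(f \<longlongrightarrow> l) (at_left t)"
    using assms by (auto simp: cadlag_def)
  then have "Lim (at_left t) f = l"
    by (intro tendsto_Lim) auto
  with l \<open>0 < t\<close> show ?thesis
    by (simp add: left_lim_def)
qed

section \<open>Chords at close times versus jump segments\<close>

text \<open>The union of balls is the open \<open>e\<close>-neighbourhood of \<open>F\<close>; it
  makes the condition on the two endpoints open even when \<open>F\<close> is closed.\<close>

definition chord_near :: "(real \<Rightarrow> 'b::real_normed_vector) \<Rightarrow> 'b set \<Rightarrow> real \<Rightarrow> real \<Rightarrow> real \<Rightarrow> bool" where
  "chord_near f F e q r \<longleftrightarrow> closed_segment (f q) (f r) \<inter> (\<Union>z\<in>F. ball z e) \<noteq> {}"

text \<open>Just before \<open>s\<close> the path is close to its left limit, just after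
  \<open>s\<close> to \<open>f s\<close>, and meeting an open set is stable under small changes of
  the endpoints.\<close>

lemma jump_segment_imp_chord_near:
  fixes f :: "real \<Rightarrow> 'b::real_normed_vector"
  assumes f: "cadlag f" and "0 < s" and meets: "closed_segment (left_lim f s) (f s) \<inter> F \<noteq> {}"
    and "a < s" "s < b" "0 < e"
  obtains q r where "q \<in> \<rat>" "r \<in> \<rat>" "a \<le> q" "q \<le> b" "a \<le> r" "r \<le> b" "\<bar>r - q\<bar> < e"
    "chord_near f F e q r"
proof -
  let ?O = "{p. closed_segment (fst p) (snd p) \<inter> (\<Union>z\<in>F. ball z e) \<noteq> {}}"
  have "(f \<longlongrightarrow> left_lim f s) (at_left s)"
    using f \<open>0 < s\<close> by (rule cadlag_tendsto_left_lim)
  moreover have "(f \<longlongrightarrow> f s) (at_right s)"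
    using f \<open>0 < s\<close> by (simp add: cadlag_def)
  moreover have "open ?O"
    by (intro open_segments_meeting) auto
  \<comment> \<open>A product neighbourhood separates the endpoints, so \<open>q\<close> can be
    chosen from the left limit alone and \<open>r\<close> from the right limit alone.\<close>
  then obtain A B where AB: "open A" "open B" "(left_lim f s, f s) \<in> A \<times> B" "A \<times> B \<subseteq> ?O"
  proof (rule open_prod_elim)
    show "(left_lim f s, f s) \<in> ?O"
      using meets \<open>0 < e\<close> by fastforce
  qed
  ultimately have "eventually (\<lambda>q. f q \<in> A) (at_left s)" "eventually (\<lambda>r. f r \<in> B) (at_right s)"
    by (auto dest: topological_tendstoD)
  then obtain c d where c: "c < s" "\<And>q. c < q \<Longrightarrow> q < s \<Longrightarrow> f q \<in> A"
      and d: "s < d" "\<And>r. s < r \<Longrightarrow> r < d \<Longrightarrow> f r \<in> B"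
    unfolding eventually_at_left_field eventually_at_right_field by blast
  \<comment> \<open>Staying within \<open>e / 2\<close> of \<open>s\<close> on each side gives
    \<open>\<bar>r - q\<bar> < e\<close>.\<close>
  have "max (max a c) (s - e / 2) < s" "s < min (min b d) (s + e / 2)"
    using assms c d by auto
  then obtain q r where "q \<in> \<rat>" "max (max a c) (s - e / 2) < q" "q < s"
      and "r \<in> \<rat>" "s < r" "r < min (min b d) (s + e / 2)"
    using Rats_dense_in_real by meson
  moreover from this have "(f q, f r) \<in> A \<times> B"
    using c d by auto
  then have "(f q, f r) \<in> ?O"
    using AB by blast
  ultimately show ?thesis
    using that[of q r] \<open>a < s\<close> \<open>s < b\<close> unfolding chord_near_def by auto
qed

text \<open>By compactness the times accumulate at some \<open>s\<close>. Near \<open>s\<close> all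
  path values, hence all chords, are close to the jump segment, so this segment cannot stay away
  from \<open>F\<close>. Since \<open>0 < a\<close>, \<open>s\<close> is positive and
  \<open>left_lim f s\<close> is a genuine left limit.\<close>

lemma chords_near_imp_jump_segment:
  fixes f :: "real \<Rightarrow> 'b::euclidean_space"
  assumes f: "cadlag f" and F: "closed F" and "0 < a"
    and near: "\<And>n. \<exists>q r. q \<in> {a..b} \<and> \<bar>r - q\<bar> < inverse (real (Suc n)) \<and>
      chord_near f F (inverse (real (Suc n))) q r"
  obtains s where "s \<in> {a..b}" "closed_segment (left_lim f s) (f s) \<inter> F \<noteq> {}"
proof -
  obtain q r where q: "\<And>n. q n \<in> {a..b}" and qr: "\<And>n. \<bar>r n - q n\<bar> < inverse (real (Suc n))"
    and chord: "\<And>n. chord_near f F (inverse (real (Suc n))) (q n) (r n)"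
    using near by metis
  have "compact {a..b}"
    by simp
  then obtain s \<phi> where s: "s \<in> {a..b}" and \<phi>: "strict_mono \<phi>" and lim_q: "(q \<circ> \<phi>) \<longlonglongrightarrow> s"
    using q unfolding compact_def by meson
  \<comment> \<open>Only \<open>q\<close> is confined to \<open>{a..b}\<close>; \<open>r\<close> is
    drawn to the same limit by the shrinking gap.\<close>
  have "(\<lambda>n. r n - q n) \<longlonglongrightarrow> 0"
    by (rule Lim_null_comparison[OF _ LIMSEQ_inverse_real_of_nat])
      (use qr in \<open>auto intro!: always_eventually less_imp_le simp del: of_nat_Suc\<close>)
  from tendsto_add[OF lim_q LIMSEQ_subseq_LIMSEQ[OF this \<phi>]]
  have lim_r: "(r \<circ> \<phi>) \<longlonglongrightarrow> s"
    by (simp add: o_def)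
  let ?S = "closed_segment (left_lim f s) (f s)"
  have "?S \<inter> F \<noteq> {}"
  proof
    assume "?S \<inter> F = {}"
    \<comment> \<open>The budget \<delta> is split in halves: one for the distance from the segment
      to a chord point, one for the distance from that point to \<open>F\<close>.\<close>
    then obtain \<delta> where "0 < \<delta>" and \<delta>: "\<And>x y. x \<in> ?S \<Longrightarrow> y \<in> F \<Longrightarrow> \<delta> \<le> dist x y"
      using separate_compact_closed[of ?S F] F by auto
    \<comment> \<open>Convex, so a chord lies near the segment as soon as its endpoints do.\<close>
    let ?N = "\<Union>x\<in>?S. \<Union>y\<in>ball 0 (\<delta> / 2). {x + y}"
    have "convex ?N"
      by (intro convex_sums) auto
    have N: "x \<in> ?N" if "dist x y < \<delta> / 2" "y \<in> ?S" for x y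
    proof -
      have "x - y \<in> ball 0 (\<delta> / 2)" "x = y + (x - y)"
        using that by (auto simp: dist_norm norm_minus_commute)
      with that show ?thesis
        by blast
    qed
    have "0 < s"
      using s \<open>0 < a\<close> by simp
    have "eventually (\<lambda>u. dist (f u) (left_lim f s) < \<delta> / 2) (at_left s)"
      using cadlag_tendsto_left_lim[OF f \<open>0 < s\<close>] \<open>0 < \<delta>\<close> by (intro tendstoD) auto
    then have "eventually (\<lambda>u. f u \<in> ?N) (at_left s)"
      by eventually_elim (rule N, auto)
    moreover have "eventually (\<lambda>u. dist (f u) (f s) < \<delta> / 2) (at_right s)"
      using f \<open>0 < s\<close> \<open>0 < \<delta>\<close> by (intro tendstoD) (auto simp: cadlag_def)
    then have "eventually (\<lambda>u. f u \<in> ?N) (at_right s)"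
      by eventually_elim (rule N, auto)
    moreover have "f s \<in> ?N"
      using \<open>0 < \<delta>\<close> by (intro N[of _ "f s"]) auto
    \<comment> \<open>The times may approach \<open>s\<close> from either side or equal it, so both
      one-sided limits and the value at \<open>s\<close> are combined.\<close>
    ultimately have ev: "eventually (\<lambda>u. f u \<in> ?N) (nhds s)"
      by (simp add: eventually_nhds_conv_at eventually_at_split)
    have "(\<lambda>n. inverse (real (Suc (\<phi> n)))) \<longlonglongrightarrow> 0"
      using LIMSEQ_subseq_LIMSEQ[OF LIMSEQ_inverse_real_of_nat \<phi>] by (simp add: o_def)
    then have "eventually (\<lambda>n. inverse (real (Suc (\<phi> n))) < \<delta> / 2) sequentially"
      by (rule order_tendstoD) (use \<open>0 < \<delta>\<close> in simp)
    moreover note eventually_compose_filterlim[OF ev lim_q] eventually_compose_filterlim[OF ev lim_r]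
    \<comment> \<open>For large \<open>n\<close> a chord point \<open>w\<close> is within \<delta>/2
      of both the segment and \<open>F\<close>, which contradicts the choice of \<delta>.\<close>
    ultimately have "eventually (\<lambda>n. False) sequentially"
    proof eventually_elim
      case (elim n)
      obtain w z where "w \<in> closed_segment (f (q (\<phi> n))) (f (r (\<phi> n)))" "z \<in> F"
          and wz: "dist z w < inverse (real (Suc (\<phi> n)))"
        using chord[of "\<phi> n"] unfolding chord_near_def by (auto simp del: of_nat_Suc)
      moreover have "closed_segment (f (q (\<phi> n))) (f (r (\<phi> n))) \<subseteq> ?N"
        using elim by (intro closed_segment_subset \<open>convex ?N\<close>) auto
      ultimately have w: "w \<in> ?N"
        by blast
      from w obtain x y where "x \<in> ?S" "norm y < \<delta> / 2" "w = x + y"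
        by auto
      then have "dist x w < \<delta> / 2"
        by (simp add: dist_norm)
      moreover have "\<delta> \<le> dist x z"
        using \<open>x \<in> ?S\<close> \<open>z \<in> F\<close> by (rule \<delta>)
      moreover have "dist x z \<le> dist x w + dist z w"
        by (rule dist_triangle2)
      ultimately show False
        using wz elim by linarith
    qed
    then show False
      by simp
  qed
  with s show ?thesis
    by (rule that)
qed

text \<open>An infimum is below \<open>c\<close> iff some jump time \<open>s\<close> is. The window
  \<open>{a..b}\<close> is fixed before \<open>n\<close>, so that the accumulation point of the
  chord times stays positive and strictly below \<open>c\<close>.\<close>

lemma shot_down_time_less_iff:
  assumes f: "cadlag (\<lambda>t. X t \<omega>)" and "open D"
  shows "shot_down_time X D \<omega> < ennreal c \<longleftrightarrow>
    (\<exists>a\<in>\<rat>. \<exists>b\<in>\<rat>. 0 < a \<and> b < c \<and>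
      (\<forall>n. \<exists>q\<in>\<rat>. \<exists>r\<in>\<rat>. q \<in> {a..b} \<and> r \<in> {a..b} \<and> \<bar>r - q\<bar> < inverse (real (Suc n)) \<and>
        chord_near (\<lambda>t. X t \<omega>) (- D) (inverse (real (Suc n))) q r))"
    (is "?L \<longleftrightarrow> ?R")
proof
  let ?f = "\<lambda>t. X t \<omega>"
  show ?R if ?L
  proof -
    from that obtain s where s: "0 < s" "closed_segment (left_lim ?f s) (?f s) \<inter> - D \<noteq> {}"
        and "ennreal s < ennreal c"
      unfolding shot_down_time_def Inf_less_iff by blast
    then have "s < c"
      by (simp add: ennreal_less_iff)
    obtain a b where "a \<in> \<rat>" "0 < a" "a < s" "b \<in> \<rat>" "s < b" "b < c"
      using Rats_dense_in_real \<open>0 < s\<close> \<open>s < c\<close> by meson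
    moreover have "\<exists>q\<in>\<rat>. \<exists>r\<in>\<rat>. q \<in> {a..b} \<and> r \<in> {a..b} \<and> \<bar>r - q\<bar> < e \<and>
        chord_near ?f (- D) e q r" if "0 < e" for e
      using jump_segment_imp_chord_near[OF f s \<open>a < s\<close> \<open>s < b\<close> that]
      by (metis atLeastAtMost_iff)
    ultimately show ?R
      by (metis inverse_positive_iff_positive of_nat_0_less_iff zero_less_Suc)
  qed
  show ?L if ?R
  proof -
    from that obtain a b where "0 < a" "b < c" and
      "\<And>n. \<exists>q r. q \<in> {a..b} \<and> \<bar>r - q\<bar> < inverse (real (Suc n)) \<and>
        chord_near ?f (- D) (inverse (real (Suc n))) q r"
      by blast
    then obtain s where "s \<in> {a..b}" "closed_segment (left_lim ?f s) (?f s) \<inter> - D \<noteq> {}"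
      using chords_near_imp_jump_segment[OF f, of "- D" a b] \<open>open D\<close> by (metis closed_Compl)
    moreover from this have "0 < s" "ennreal s < ennreal c"
      using \<open>0 < a\<close> \<open>b < c\<close> by (auto simp: ennreal_less_iff)
    ultimately show ?L
      unfolding shot_down_time_def Inf_less_iff by blast
  qed
qed

section \<open>Measurability and the stopping time property\<close>

lemma measurable_natural_filtration:
  assumes "0 \<le> s" "ennreal s \<le> t"
  shows "X s \<in> borel_measurable (natural_filtration M X t)"
proof (rule measurableI)
  fix B :: "'b set" assume "B \<in> sets borel"
  with assms show "X s -` B \<inter> space (natural_filtration M X t) \<in> sets (natural_filtration M X t)"
    unfolding space_natural_filtration unfolding natural_filtration_def
    by (intro in_measure_of) auto
qed simp

text \<open>The criterion involves countably many chord events, all at times in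
  \<open>(0, c)\<close>, so the raw filtration suffices, without null sets.\<close>

lemma sets_shot_down_time_less:
  fixes X :: "real \<Rightarrow> 'w \<Rightarrow> 'b::euclidean_space"
  assumes cadlag: "\<And>\<omega>. \<omega> \<in> space M \<Longrightarrow> cadlag (\<lambda>t. X t \<omega>)" and "open D"
  shows "{\<omega> \<in> space M. shot_down_time X D \<omega> < ennreal c} \<in>
    sets (natural_filtration M X (ennreal c))"
proof -
  let ?N = "natural_filtration M X (ennreal c)"
  have chord: "Measurable.pred ?N (\<lambda>\<omega>. chord_near (\<lambda>t. X t \<omega>) (- D) e q r)"
    if "0 \<le> q" "q \<le> c" "0 \<le> r" "r \<le> c" for e q r
  proof -
    let ?O = "{p::'b \<times> 'b. closed_segment (fst p) (snd p) \<inter> (\<Union>z\<in>- D. ball z e) \<noteq> {}}"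
    have "open ?O"
      by (intro open_segments_meeting) auto
    then have "?O \<in> sets borel"
      by simp
    moreover have "(\<lambda>\<omega>. (X q \<omega>, X r \<omega>)) \<in> borel_measurable ?N"
      using that by (intro borel_measurable_Pair measurable_natural_filtration ennreal_leI)
    ultimately have "Measurable.pred ?N (\<lambda>\<omega>. (X q \<omega>, X r \<omega>) \<in> ?O)"
      by (rule pred_sets2)
    then show ?thesis
      by (simp add: chord_near_def)
  qed
  have Bex_Rats: "Measurable.pred ?N (\<lambda>\<omega>. \<exists>x\<in>\<rat>. P x \<omega>)"
    if "\<And>x. Measurable.pred ?N (P x)" for P :: "real \<Rightarrow> 'w \<Rightarrow> bool"
    using that unfolding pred_def
    by (intro sets.sets_Collect_countable_Ex' countable_rat) auto
  have "Measurable.pred ?N (\<lambda>\<omega>. \<exists>a\<in>\<rat>. \<exists>b\<in>\<rat>. 0 < a \<and> b < c \<and>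
      (\<forall>n. \<exists>q\<in>\<rat>. \<exists>r\<in>\<rat>. q \<in> {a..b} \<and> r \<in> {a..b} \<and> \<bar>r - q\<bar> < inverse (real (Suc n)) \<and>
        chord_near (\<lambda>t. X t \<omega>) (- D) (inverse (real (Suc n))) q r))"
    \<comment> \<open>The conditions on the times do not depend on \<omega>; once split off, they
      supply the bounds \<open>0\<close> and \<open>c\<close> that \<open>chord\<close>
      requires.\<close>
    by (intro Bex_Rats pred_intros_countable pred_intros_conj1' chord) auto
  then have "{\<omega> \<in> space ?N. \<exists>a\<in>\<rat>. \<exists>b\<in>\<rat>. 0 < a \<and> b < c \<and>
      (\<forall>n. \<exists>q\<in>\<rat>. \<exists>r\<in>\<rat>. q \<in> {a..b} \<and> r \<in> {a..b} \<and> \<bar>r - q\<bar> < inverse (real (Suc n)) \<and>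
        chord_near (\<lambda>t. X t \<omega>) (- D) (inverse (real (Suc n))) q r)} \<in> sets ?N"
    by (simp add: pred_def)
  also have "{\<omega> \<in> space ?N. \<exists>a\<in>\<rat>. \<exists>b\<in>\<rat>. 0 < a \<and> b < c \<and>
      (\<forall>n. \<exists>q\<in>\<rat>. \<exists>r\<in>\<rat>. q \<in> {a..b} \<and> r \<in> {a..b} \<and> \<bar>r - q\<bar> < inverse (real (Suc n)) \<and>
        chord_near (\<lambda>t. X t \<omega>) (- D) (inverse (real (Suc n))) q r)} =
      {\<omega> \<in> space M. shot_down_time X D \<omega> < ennreal c}"
    unfolding space_natural_filtration
    by (intro Collect_cong conj_cong refl shot_down_time_less_iff[symmetric] cadlag \<open>open D\<close>)
  finally show ?thesis .
qed

text \<open>For every \<open>s > t\<close>, \<open>{T \<le> t}\<close> is the intersection of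
  \<open>{T < c}\<close> over rational \<open>c\<close> between \<open>t\<close> and
  \<open>s\<close>; right continuity then lets \<open>s\<close> decrease to
  \<open>t\<close>.\<close>

lemma stopping_time_usual_filtrationI:
  assumes less: "\<And>c. {\<omega> \<in> space M. T \<omega> < ennreal c} \<in> sets (natural_filtration M X (ennreal c))"
  shows "stopping_time (usual_filtration M X) T"
  unfolding stopping_time_def
proof
  fix t :: ennreal
  show "Measurable.pred (usual_filtration M X t) (\<lambda>\<omega>. T \<omega> \<le> t)"
  proof (cases "t = \<infinity>")
    case False
    have "{\<omega> \<in> space M. T \<omega> \<le> t} \<in> sets (completed_filtration M X s)" if "t < s" for s
    proof -
      let ?C = "{c \<in> \<rat>. t < ennreal c \<and> ennreal c < s}"
      have dense: "\<exists>c\<in>?C. ennreal c < y" if "t < y" for y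
      proof -
        have "t < min s y"
          using \<open>t < s\<close> that by simp
        \<comment> \<open>Since \<open>s\<close> and \<open>y\<close> may be \<infinity>, finite
          \<open>u\<close> and \<open>v\<close> are interposed to reduce to density of the rationals
          in the reals.\<close>
        then obtain u v where "t < u" "u < v" "v < min s y"
          by (meson dense)
        moreover from this have "u < top" "v < top"
          by (auto intro: less_le_trans[OF _ top_greatest])
        ultimately obtain u' v' where "0 \<le> u'" "0 \<le> v'" "u = ennreal u'" "v = ennreal v'"
          unfolding less_top_ennreal by blast
        moreover from this obtain c where "c \<in> \<rat>" "u' < c" "c < v'"
          using \<open>u < v\<close> Rats_dense_in_real by (metis ennreal_less_iff)
        ultimately have "u < ennreal c" "ennreal c < v"
          by (auto simp: ennreal_less_iff)
        with \<open>c \<in> \<rat>\<close> \<open>t < u\<close> \<open>v < min s y\<close> show ?thesis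
          by (intro bexI[of _ c]) (auto intro: less_trans)
      qed
      have "T \<omega> \<le> t \<longleftrightarrow> (\<forall>c\<in>?C. T \<omega> < ennreal c)" for \<omega>
      proof
        show "\<forall>c\<in>?C. T \<omega> < ennreal c" if "T \<omega> \<le> t"
          using that by (auto intro: le_less_trans)
        show "T \<omega> \<le> t" if "\<forall>c\<in>?C. T \<omega> < ennreal c"
        proof (rule ccontr)
          assume "\<not> T \<omega> \<le> t"
          then obtain c where "c \<in> ?C" "ennreal c < T \<omega>"
            using dense[of "T \<omega>"] by (auto simp: not_le)
          with that show False
            using less_asym by blast
        qed
      qed
      \<comment> \<open>An empty intersection would be the whole type instead of a subset of
        \<open>space M\<close>.\<close>
      moreover have "?C \<noteq> {}"
        using dense[OF \<open>t < s\<close>] by blast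
      ultimately have "{\<omega> \<in> space M. T \<omega> \<le> t} = (\<Inter>c\<in>?C. {\<omega> \<in> space M. T \<omega> < ennreal c})"
        by blast
      also have "\<dots> \<in> sets (natural_filtration M X s)"
      proof (rule sets.countable_INT')
        show "countable ?C"
          using countable_rat by (rule countable_subset[rotated]) auto
        show "(\<lambda>c. {\<omega> \<in> space M. T \<omega> < ennreal c}) ` ?C \<subseteq> sets (natural_filtration M X s)"
          using less sets_natural_filtration_mono[of _ s M X] by (blast intro: less_imp_le)
      qed (fact \<open>?C \<noteq> {}\<close>)
      also have "\<dots> \<subseteq> sets (completed_filtration M X s)"
        unfolding completed_filtration_def sets_measure_of[OF completed_filtration_generator] by auto
      finally show ?thesis .
    qed
    with False show ?thesis
      by (simp add: pred_def space_usual_filtration sets_usual_filtration)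
  qed simp
qed

theorem theorem1p2:
  fixes M :: "'w measure"
    and X :: "real \<Rightarrow> 'w \<Rightarrow> real ^ 'd"
    and \<alpha> :: real
    and D :: "(real ^ 'd) set"
  assumes "0 < \<alpha>" "\<alpha> < 2"
    and "isotropic_stable_process M X \<alpha>"
    and "open D" "D \<noteq> {}"
  shows "stopping_time (usual_filtration M X) (shot_down_time X D)"
proof -
  interpret isotropic_stable_process M X \<alpha>
    by fact
  show ?thesis
    by (intro stopping_time_usual_filtrationI sets_shot_down_time_less cadlag_paths \<open>open D\<close>)
qed

end
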